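(* Let $(X,d)$ be a compact metric space, let $f\colon X\to X$ be a homeomorphism, and let $\Lambda$ be an attractor for $f$. If $f$ has shadowing on $B_b(\Lambda)$ for some $b>0$, then the boundary $\partial\Lambda$ is chain stable.
   Context: For $S\subset X$, $\partial S=\overline{S}\setminus{\rm int}[S]$ is the boundary, and for $r>0$, $B_r(S)=\{x\in X: d(x,S)\le r\}$, where $d(x,S)=\inf_{y\in S}d(x,y)$. An attractor for a homeomorphism $f$ is a closed subset $\Lambda$ of $X$ with $f(\Lambda)=\Lambda$ such that there is an open subset $U$ of $X$ with $f(\overline{U})\subset U$ and $\Lambda=\bigcap_{i\ge0}f^i(U)$. For $\delta>0$, a $\delta$-chain of $f$ is a finite sequence $(x_i)_{i=0}^k$ in $X$, $k\ge1$, with $d(f(x_i),x_{i+1})\le\delta$ for $0\le i\le k-1$. $f$ has shadowing on $S\subset X$ if for any $\epsilon>0$ there is $\delta>0$ such that for every $\delta$-chain $(x_i)_{i=0}^k$ of $f$ with all $x_i\in S$ there is $x\in X$ with $\sup_{0\le i\le k}d(x_i,f^i(x))\le\epsilon$. A closed subset $S$ of $X$ with $f(S)\subset S$ is chain stable if for any $\epsilon>0$ there is $\delta>0$ such that every $\delta$-chain $(x_i)_{i=0}^k$ of $f$ with $x_0\in S$ satisfies $d(x_k,S)\le\epsilon$. *)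

theory Defs
  imports "HOL-Analysis.Analysis"
begin

text \<open>
  The space \<open>X\<close> is the whole type \<open>'a\<close>; its compactness is the assumption
  \<open>compact (UNIV :: 'a set)\<close>. The boundary of \<open>S\<close> is the library's
  \<open>frontier S\<close>, i.e. \<open>closure S - interior S\<close>.
\<close>

text \<open>
  The distance \<open>d(x, S)\<close> is \<open>infdist x S\<close>. The library sets \<open>infdist x {} = 0\<close>, whereas
  the infimum over the empty set is infinite; the guard makes the neighbourhood of the empty
  set empty.
\<close>

definition closed_nbhd :: "real \<Rightarrow> 'a::metric_space set \<Rightarrow> 'a set" where
  "closed_nbhd r S = {x. S \<noteq> {} \<and> infdist x S \<le> r}"

definition attractor :: "('a::metric_space \<Rightarrow> 'a) \<Rightarrow> 'a set \<Rightarrow> bool" where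
  "attractor f L \<longleftrightarrow> closed L \<and> f ` L = L \<and>
     (\<exists>U. open U \<and> f ` closure U \<subseteq> U \<and> L = (\<Inter>i. (f ^^ i) ` U))"

text \<open>
  A finite sequence \<open>(x\<^sub>i)\<close>, \<open>0 \<le> i \<le> k\<close>, is a function on \<open>nat\<close> of which only the values
  at \<open>0, \<dots>, k\<close> are used.
\<close>

definition delta_chain :: "('a::metric_space \<Rightarrow> 'a) \<Rightarrow> real \<Rightarrow> nat \<Rightarrow> (nat \<Rightarrow> 'a) \<Rightarrow> bool" where
  "delta_chain f \<delta> k x \<longleftrightarrow> k \<ge> 1 \<and> (\<forall>i<k. dist (f (x i)) (x (Suc i)) \<le> \<delta>)"

definition shadowing_on :: "('a::metric_space \<Rightarrow> 'a) \<Rightarrow> 'a set \<Rightarrow> bool" where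
  "shadowing_on f S \<longleftrightarrow>
     (\<forall>\<epsilon>>0. \<exists>\<delta>>0. \<forall>k x. delta_chain f \<delta> k x \<and> (\<forall>i\<le>k. x i \<in> S) \<longrightarrow>
        (\<exists>z. (SUP i\<in>{0..k}. dist (x i) ((f ^^ i) z)) \<le> \<epsilon>))"

text \<open>
  Below, \<open>infdist (x k) S\<close> is used only for nonempty \<open>S\<close>, because \<open>x 0 \<in> S\<close>.
\<close>

definition chain_stable :: "('a::metric_space \<Rightarrow> 'a) \<Rightarrow> 'a set \<Rightarrow> bool" where
  "chain_stable f S \<longleftrightarrow> closed S \<and> f ` S \<subseteq> S \<and>
     (\<forall>\<epsilon>>0. \<exists>\<delta>>0. \<forall>k x. delta_chain f \<delta> k x \<and> x 0 \<in> S \<longrightarrow> infdist (x k) S \<le> \<epsilon>)"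

end

theory Submission
  imports Defs
begin

text \<open>
  A fine chain that starts on \<open>frontier \<Lambda>\<close> stays in a small trapping neighbourhood \<open>V\<close> of \<open>\<Lambda>\<close>, so
  it can only move away from the frontier into the interior of \<open>\<Lambda>\<close>. If it did, one could replace
  its past by the orbit of a nearby point \<open>y \<notin> \<Lambda>\<close>; traced back, this orbit leaves \<open>V\<close>, hence visits
  some \<open>p \<in> V - f ` V\<close>, which is at a definite distance from \<open>\<Lambda>\<close>. A point that shadows the
  chain from \<open>p\<close> into the interior ends in \<open>\<Lambda>\<close>, so it starts in the invariant set \<open>\<Lambda>\<close>, although
  it starts close to \<open>p\<close>.
\<close>

section \<open>Compactness and homeomorphisms of the whole space\<close>

text \<open>Lebesgue's number for the one-set cover \<open>{W}\<close>. It supplies the margins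
  \<open>c\<close>, \<open>\<eta>\<close> and \<open>\<delta>0\<close> of the main proof.\<close>

lemma compact_subset_open_uniform:
  fixes K :: "'a::metric_space set"
  assumes "compact K" "open W" "K \<subseteq> W"
  obtains e where "e > 0" "\<And>x y. x \<in> K \<Longrightarrow> dist x y < e \<Longrightarrow> y \<in> W"
proof -
  have "K \<subseteq> \<Union>{W}" "\<And>B. B \<in> {W} \<Longrightarrow> open B"
    using assms by auto
  from Heine_Borel_lemma[OF assms(1) this]
  obtain e where "e > 0" "\<And>x. x \<in> K \<Longrightarrow> \<exists>B\<in>{W}. ball x e \<subseteq> B"
    by metis
  then show ?thesis
    by (intro that[of e]) (auto simp: subset_iff)
qed

lemma open_image_homeomorphism_UNIV:
  assumes "homeomorphism UNIV UNIV f g" "open S"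
  shows "open (f ` S)"
  using homeomorphism_imp_open_map[OF assms(1), of S] assms(2) by auto

lemma homeomorphism_UNIV_funpow:
  fixes f g :: "'a::topological_space \<Rightarrow> 'a"
  assumes "homeomorphism UNIV UNIV f g"
  shows "homeomorphism UNIV UNIV (f ^^ n) (g ^^ n)"
proof (induction n)
  case 0
  then show ?case
    by (simp add: homeomorphism_def)
next
  case (Suc n)
  have "homeomorphism UNIV UNIV (f \<circ> f ^^ n) (g ^^ n \<circ> g)"
    using homeomorphism_compose[OF Suc assms] .
  then show ?case
    by (simp add: funpow_swap1 comp_def)
qed

lemma inj_homeomorphism_UNIV:
  assumes "homeomorphism UNIV UNIV f g"
  shows "inj f"
  using assms by (metis UNIV_I homeomorphism_apply1 injI)

section \<open>Trapping neighbourhoods and the frontier of an invariant set\<close>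

lemma attractor_trapping_neighbourhood:
  fixes f :: "'a::metric_space \<Rightarrow> 'a"
  assumes X: "compact (UNIV :: 'a set)"
    and hom: "homeomorphism UNIV UNIV f g"
    and L: "attractor f L"
    and W: "open W" "L \<subseteq> W"
  obtains V where "open V" "L \<subseteq> V" "V \<subseteq> W" "f ` closure V \<subseteq> V"
    "L = (\<Inter>i. (f ^^ i) ` V)"
proof -
  obtain U where U: "open U" "f ` closure U \<subseteq> U" "L = (\<Inter>i. (f ^^ i) ` U)"
    using L by (auto simp: attractor_def)
  have homn: "homeomorphism UNIV UNIV (f ^^ n) (g ^^ n)" for n
    using homeomorphism_UNIV_funpow[OF hom] .
  have cpt: "compact ((f ^^ n) ` closure U)" for n
  proof (rule compact_continuous_image)
    show "continuous_on (closure U) (f ^^ n)"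
      using homn[of n] by (meson continuous_on_subset homeomorphism_cont1 subset_UNIV)
    show "compact (closure U)"
      using compact_Int_closed[OF X closed_closure[of U]] by simp
  qed
  \<comment> \<open>Closed and open iterates interlace. This gives monotonicity, shows that closures
    do not enlarge the intersection, and later makes \<open>V\<close> trapping.\<close>
  have step: "(f ^^ Suc n) ` closure U \<subseteq> (f ^^ n) ` U" for n
  proof -
    have "(f ^^ Suc n) ` closure U = (f ^^ n) ` f ` closure U"
      by (simp add: image_image funpow_swap1)
    then show ?thesis
      using U(2) by (metis image_mono)
  qed
  have nest: "decseq (\<lambda>n. (f ^^ n) ` closure U)"
    unfolding decseq_Suc_iff
    using order_trans[OF step image_mono[OF closure_subset]] by blast
  have inter: "(\<Inter>n. (f ^^ n) ` closure U) \<subseteq> L"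
  proof -
    have "(\<Inter>n. (f ^^ n) ` closure U) \<subseteq> (f ^^ i) ` U" for i
      using INF_lower[OF UNIV_I] step by (rule order_trans)
    then show ?thesis
      unfolding U(3) by (rule INF_greatest)
  qed
  obtain N where N: "(f ^^ N) ` closure U \<subseteq> W"
  proof (rule ccontr)
    assume "\<not> thesis"
    then have no: "\<not> (f ^^ n) ` closure U \<subseteq> W" for n
      using that by blast
    \<comment> \<open>These closed sets decrease and are nonempty, so they have a common point; by
      \<open>inter\<close> it would lie in \<open>L\<close> but outside \<open>W\<close>.\<close>
    have "UNIV \<inter> (\<Inter>n. (f ^^ n) ` closure U - W) \<noteq> {}"
    proof (rule compact_imp_fip_image[OF X])
      show "closed ((f ^^ n) ` closure U - W)" for n
        using W(1) cpt by (intro closed_Diff compact_imp_closed)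
      show "UNIV \<inter> (\<Inter>n\<in>I. (f ^^ n) ` closure U - W) \<noteq> {}" if "finite I" for I
      proof -
        obtain M where M: "\<forall>n\<in>I. n \<le> M"
          using \<open>finite I\<close> finite_nat_set_iff_bounded_le by blast
        obtain u where "u \<in> (f ^^ M) ` closure U - W"
          using no by blast
        moreover have "(f ^^ M) ` closure U \<subseteq> (f ^^ n) ` closure U" if "n \<in> I" for n
          using decseqD[OF nest] M that by simp
        ultimately have "u \<in> (\<Inter>n\<in>I. (f ^^ n) ` closure U - W)"
          by auto
        then show ?thesis
          by blast
      qed
    qed
    then show False
      using inter W(2) by blast
  qed
  define V where "V = (f ^^ N) ` U"
  have clV: "closure V \<subseteq> (f ^^ N) ` closure U"
    unfolding V_def
    by (intro closure_minimal image_mono closure_subset compact_imp_closed cpt)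
  show ?thesis
  proof
    show "open V"
      unfolding V_def using open_image_homeomorphism_UNIV[OF homn U(1)] .
    show "L \<subseteq> V"
      unfolding V_def U(3) by (rule INF_lower) simp
    show "V \<subseteq> W"
      using N clV closure_subset[of V] by simp
    show "f ` closure V \<subseteq> V"
    proof -
      have "f ` closure V \<subseteq> (f ^^ Suc N) ` closure U"
        using image_mono[OF clV, of f] by (simp add: image_comp)
      then show ?thesis
        using step[of N] unfolding V_def by (rule order_trans)
    qed
    show "L = (\<Inter>i. (f ^^ i) ` V)"
    proof
      \<comment> \<open>Starting from \<open>V\<close> only shifts the index by \<open>N\<close>,
        which gives one inclusion; the other compares \<open>V\<close> with
        \<open>closure U\<close>.\<close>
      have "(f ^^ i) ` V = (f ^^ (i + N)) ` U" for i
        by (simp add: V_def funpow_add image_comp)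
      then show "L \<subseteq> (\<Inter>i. (f ^^ i) ` V)"
        unfolding U(3) by (auto intro: INF_lower)
      have "V \<subseteq> closure U"
        using decseqD[OF nest, of 0 N] closure_subset[of U] unfolding V_def by auto
      then have "(\<Inter>i. (f ^^ i) ` V) \<subseteq> (\<Inter>i. (f ^^ i) ` closure U)"
        by (intro INF_mono' image_mono)
      then show "(\<Inter>i. (f ^^ i) ` V) \<subseteq> L"
        using inter by (rule order_trans)
    qed
  qed
qed

text \<open>If \<open>f x\<close> were interior, \<open>g\<close>, which also preserves
  \<open>L\<close>, would carry \<open>interior L\<close> to an open subset of \<open>L\<close>
  around \<open>x\<close>.\<close>

lemma frontier_image_homeomorphism_UNIV:
  assumes hom: "homeomorphism UNIV UNIV f g" and L: "closed L" "f ` L = L"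
  shows "f ` frontier L \<subseteq> frontier L"
proof
  fix z assume "z \<in> f ` frontier L"
  then obtain x where x: "x \<in> frontier L" "z = f x"
    by blast
  have gL: "g ` L = L"
  proof -
    have "g ` f ` L = L"
      using hom by (simp add: image_image homeomorphism_def)
    then show ?thesis
      by (simp only: L(2))
  qed
  have "z \<in> L"
    using x(1) frontier_subset_closed[OF L(1)] imageI[of x L f] unfolding x(2) L(2) by blast
  moreover have "z \<notin> interior L"
  proof
    assume z: "z \<in> interior L"
    have "open (g ` interior L)"
      by (rule open_image_homeomorphism_UNIV[OF homeomorphism_symD[OF hom] open_interior])
    moreover have "g ` interior L \<subseteq> L"
      using image_mono[OF interior_subset, of g L] gL by simp
    moreover have "x \<in> g ` interior L"
      using z x hom by (metis UNIV_I homeomorphism_apply1 imageI)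
    ultimately have "x \<in> interior L"
      by (metis interiorI)
    then show False
      using x by (simp add: frontier_def)
  qed
  ultimately show "z \<in> frontier L"
    using L(1) by (simp add: frontier_def)
qed

section \<open>Chains and shadowing\<close>

lemma delta_chain_in_trapping_set:
  assumes chain: "delta_chain f \<delta> k x" and x0: "x 0 \<in> V"
    and trap: "\<And>u v. u \<in> V \<Longrightarrow> dist (f u) v \<le> \<delta> \<Longrightarrow> v \<in> V"
    and "i \<le> k"
  shows "x i \<in> V"
  using \<open>i \<le> k\<close>
proof (induction i)
  case (Suc i)
  then show ?case
    using trap[of "x i" "x (Suc i)"] chain by (auto simp: delta_chain_def)
qed (simp add: x0)

text \<open>An orbit segment makes no error, so the only possible new jump is at index
  \<open>n\<close>, where \<open>x 0\<close> takes the place of \<open>(f ^^ n) p\<close>.\<close>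

lemma delta_chain_prepend_orbit:
  assumes chain: "delta_chain f \<delta> k x" and "\<delta> \<ge> 0"
    and y: "dist ((f ^^ n) p) (x 0) \<le> \<delta>"
  shows "delta_chain f \<delta> (n + k) (\<lambda>i. if i < n then (f ^^ i) p else x (i - n))"
    (is "delta_chain f \<delta> _ ?w")
proof -
  have "dist (f (?w i)) (?w (Suc i)) \<le> \<delta>" if i: "i < n + k" for i
  proof -
    consider "Suc i < n" | "Suc i = n" | "n \<le> i"
      by linarith
    then show ?thesis
    proof cases
      case 3
      then show ?thesis
        using chain i by (simp add: delta_chain_def Suc_diff_le)
    qed (use y \<open>\<delta> \<ge> 0\<close> in auto)
  qed
  then show ?thesis
    using chain by (simp add: delta_chain_def)
qed

text \<open>The supremum ranges over the finite set \<open>{0..k}\<close>, so it really bounds every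
  term.\<close>

lemma shadowing_onE:
  assumes "shadowing_on f S" "\<epsilon> > 0"
  obtains \<delta> where "\<delta> > 0"
    "\<And>k x. delta_chain f \<delta> k x \<Longrightarrow> (\<And>i. i \<le> k \<Longrightarrow> x i \<in> S)
      \<Longrightarrow> \<exists>z. \<forall>i\<le>k. dist (x i) ((f ^^ i) z) \<le> \<epsilon>"
proof -
  obtain \<delta> where "\<delta> > 0" and sh: "\<forall>k x. delta_chain f \<delta> k x \<and> (\<forall>i\<le>k. x i \<in> S)
      \<longrightarrow> (\<exists>z. (SUP i\<in>{0..k}. dist (x i) ((f ^^ i) z)) \<le> \<epsilon>)"
    using assms(1)[unfolded shadowing_on_def, rule_format, OF assms(2)] by (elim exE conjE)
  show ?thesis
  proof (rule that[OF \<open>\<delta> > 0\<close>])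
    fix k x assume "delta_chain f \<delta> k x" "\<And>i. i \<le> k \<Longrightarrow> x i \<in> S"
    then have "\<exists>z. (SUP i\<in>{0..k}. dist (x i) ((f ^^ i) z)) \<le> \<epsilon>"
      using sh by simp
    then obtain z where z: "(SUP i\<in>{0..k}. dist (x i) ((f ^^ i) z)) \<le> \<epsilon>" ..
    have "dist (x i) ((f ^^ i) z) \<le> \<epsilon>" if "i \<le> k" for i
    proof -
      have "dist (x i) ((f ^^ i) z) \<le> (SUP i\<in>{0..k}. dist (x i) ((f ^^ i) z))"
        using that by (intro cSUP_upper) auto
      then show ?thesis
        using z by (rule order_trans)
    qed
    then show "\<exists>z. \<forall>i\<le>k. dist (x i) ((f ^^ i) z) \<le> \<epsilon>"
      by blast
  qed
qed

section \<open>Chain stability of the frontier\<close>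

theorem theorem1p2:
  fixes f g :: "'a::metric_space \<Rightarrow> 'a" and \<Lambda> :: "'a set" and b :: real
  assumes "compact (UNIV :: 'a set)"
    and "homeomorphism UNIV UNIV f g"
    and "attractor f \<Lambda>"
    and "b > 0"
    and "shadowing_on f (closed_nbhd b \<Lambda>)"
  shows "chain_stable f (frontier \<Lambda>)"
proof -
  note X = assms(1) and hom = assms(2)
  have L: "closed \<Lambda>" "f ` \<Lambda> = \<Lambda>"
    using assms(3) by (auto simp: attractor_def)
  have cpt: "compact S" if "closed S" for S :: "'a set"
    using compact_Int_closed[OF X that] by simp
  have "\<exists>\<delta>>0. \<forall>k x. delta_chain f \<delta> k x \<and> x 0 \<in> frontier \<Lambda> \<longrightarrow> infdist (x k) (frontier \<Lambda>) \<le> \<epsilon>"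
    if "\<epsilon> > 0" for \<epsilon>
  proof (cases "frontier \<Lambda> = {}")
    case True
    then show ?thesis
      by (intro exI[of _ 1]) auto
  next
    case False
    have frL: "frontier \<Lambda> \<subseteq> \<Lambda>"
      using L(1) frontier_subset_closed by blast
    with False have ne: "\<Lambda> \<noteq> {}"
      by blast
    \<comment> \<open>The first factor keeps chains where shadowing is assumed; by the second, a
      point of \<open>W\<close> at distance at least \<epsilon> from the frontier is interior to
      \<Lambda>.\<close>
    define W where "W = {x. infdist x \<Lambda> < b} \<inter> ({x. infdist x (frontier \<Lambda>) < \<epsilon>} \<union> interior \<Lambda>)"
    have "open W"
      unfolding W_def by (intro open_Int open_Un open_Collect_less continuous_intros open_interior)
    have "\<Lambda> \<subseteq> W"
    proof
      fix x assume x: "x \<in> \<Lambda>"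
      then have "x \<in> frontier \<Lambda> \<or> x \<in> interior \<Lambda>"
        using closure_subset by (auto simp: frontier_def)
      then show "x \<in> W"
        using x \<open>b > 0\<close> \<open>\<epsilon> > 0\<close> by (auto simp: W_def)
    qed
    obtain V where V: "open V" "\<Lambda> \<subseteq> V" "V \<subseteq> W" "f ` closure V \<subseteq> V"
        "\<Lambda> = (\<Inter>i. (f ^^ i) ` V)"
      by (rule attractor_trapping_neighbourhood
            [OF X hom assms(3) \<open>open W\<close> \<open>\<Lambda> \<subseteq> W\<close>])
    have fV: "f ` V \<subseteq> V"
      using V(4) closure_subset by blast
    have open_fV: "open (f ` V)" and LfV: "\<Lambda> \<subseteq> f ` V"
      using open_image_homeomorphism_UNIV[OF hom V(1)] V(2) L(2) by blast+
    have Vb: "V \<subseteq> closed_nbhd b \<Lambda>"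
      using V(3) ne by (auto simp: W_def closed_nbhd_def)
    \<comment> \<open>Read contrapositively: points outside f(V) have distance at least
      \<open>c\<close> from every point of \<Lambda>.\<close>
    obtain c where c: "c > 0" "\<And>x y. x \<in> \<Lambda> \<Longrightarrow> dist x y < c \<Longrightarrow> y \<in> f ` V"
      using compact_subset_open_uniform[OF cpt[OF L(1)] open_fV LfV] by blast
    \<comment> \<open>A chain in \<open>V\<close> that violates the bound must end in
      \<open>K\<close>, a compact part of the interior; hence the uniform margin \<eta>.\<close>
    define K where "K = \<Lambda> \<inter> {x. \<epsilon> \<le> infdist x (frontier \<Lambda>)}"
    have "closed K"
      unfolding K_def by (intro closed_Int L closed_Collect_le continuous_intros)
    moreover have "K \<subseteq> interior \<Lambda>"
    proof
      fix x assume x: "x \<in> K"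
      then have "x \<notin> frontier \<Lambda>"
        using \<open>\<epsilon> > 0\<close> by (auto simp: K_def)
      then show "x \<in> interior \<Lambda>"
        using x closure_subset by (auto simp: K_def frontier_def)
    qed
    ultimately obtain \<eta> where \<eta>: "\<eta> > 0" "\<And>x y. x \<in> K \<Longrightarrow> dist x y < \<eta> \<Longrightarrow> y \<in> interior \<Lambda>"
      using compact_subset_open_uniform[OF cpt open_interior] by blast
    have "continuous_on (closure V) f"
      using hom by (meson continuous_on_subset homeomorphism_cont1 subset_UNIV)
    then have "compact (f ` closure V)"
      by (intro compact_continuous_image cpt) auto
    then obtain \<delta>0 where \<delta>0: "\<delta>0 > 0"
        "\<And>x y. x \<in> f ` closure V \<Longrightarrow> dist x y < \<delta>0 \<Longrightarrow> y \<in> V"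
      using compact_subset_open_uniform V(1,4) by metis
    \<comment> \<open>One accuracy serves both ends of the shadowing orbit: \<open>c\<close> is for
      its start and \<eta> for its end. Halving makes the inequalities strict.\<close>
    define \<epsilon>' where "\<epsilon>' = min c \<eta> / 2"
    have \<epsilon>': "\<epsilon>' > 0" "\<epsilon>' < c" "\<epsilon>' < \<eta>"
      using c(1) \<eta>(1) by (auto simp: \<epsilon>'_def)
    obtain \<delta>1 where \<delta>1: "\<delta>1 > 0"
      "\<And>k x. delta_chain f \<delta>1 k x \<Longrightarrow> (\<And>i. i \<le> k \<Longrightarrow> x i \<in> closed_nbhd b \<Lambda>)
        \<Longrightarrow> \<exists>z. \<forall>i\<le>k. dist (x i) ((f ^^ i) z) \<le> \<epsilon>'"
      by (rule shadowing_onE[OF assms(5) \<epsilon>'(1)]) blast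
    define \<delta> where "\<delta> = min \<delta>0 \<delta>1 / 2"
    have \<delta>: "\<delta> > 0" "\<delta> < \<delta>0" "\<delta> \<le> \<delta>1"
      using \<delta>0(1) \<delta>1(1) by (auto simp: \<delta>_def)
    have "infdist (x k) (frontier \<Lambda>) \<le> \<epsilon>"
      if chain: "delta_chain f \<delta> k x" and x0: "x 0 \<in> frontier \<Lambda>" for k x
    proof (rule ccontr)
      assume far: "\<not> ?thesis"
      have xV: "x i \<in> V" if "i \<le> k" for i
      proof (rule delta_chain_in_trapping_set[OF chain _ _ that])
        show "x 0 \<in> V"
          using x0 frL V(2) by blast
        show "v \<in> V" if "u \<in> V" "dist (f u) v \<le> \<delta>" for u v
          using \<delta>0(2)[of "f u" v] that \<delta>(2) closure_subset[of V] by auto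
      qed
      have xK: "x k \<in> K"
        using xV[of k] V(3) far interior_subset[of \<Lambda>] by (auto simp: W_def K_def)
      \<comment> \<open>Points outside \<Lambda> accumulate at \<open>x 0\<close>. Choosing
        \<open>y\<close> in f(V), not merely in \<open>V\<close>, excludes \<open>m = 1\<close> and
        so yields \<open>n > 0\<close>.\<close>
      have "open (f ` V \<inter> ball (x 0) \<delta>)" "x 0 \<in> f ` V \<inter> ball (x 0) \<delta>"
        using open_fV LfV frL x0 \<delta>(1) by auto
      moreover have "x 0 \<notin> interior \<Lambda>"
        using x0 by (simp add: frontier_def)
      ultimately have "\<not> f ` V \<inter> ball (x 0) \<delta> \<subseteq> \<Lambda>"
        using interiorI by blast
      then obtain y where y: "y \<in> f ` V" "dist (x 0) y < \<delta>" "y \<notin> \<Lambda>"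
        by (meson IntD1 IntD2 mem_ball subsetI)
      \<comment> \<open>Some iterate of \<open>V\<close> misses \<open>y\<close>, since
        \<open>y\<close> is not in \<Lambda>. Just before the first such iterate, \<open>y\<close>
        is the image under \<open>f ^^ n\<close> of a point \<open>p\<close> in \<open>V\<close> but
        not in f(V).\<close>
      define m where "m = (LEAST i. y \<notin> (f ^^ i) ` V)"
      have "\<exists>i. y \<notin> (f ^^ i) ` V"
        using y(3) V(5) by blast
      then have m: "y \<notin> (f ^^ m) ` V"
        unfolding m_def by (rule LeastI_ex)
      have "y \<in> (f ^^ 0) ` V" "y \<in> (f ^^ 1) ` V"
        using y(1) fV by auto
      then have "m \<noteq> 0" "m \<noteq> 1"
        using m by metis+
      then obtain n where n: "m = Suc n" "n > 0"
        by (cases m) auto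
      have "y \<in> (f ^^ n) ` V"
        using not_less_Least[of n "\<lambda>i. y \<notin> (f ^^ i) ` V"] n(1) unfolding m_def[symmetric] by auto
      then obtain p where p: "p \<in> V" "y = (f ^^ n) p"
        by blast
      have pf: "p \<notin> f ` V"
        using m p unfolding n(1) by (auto simp: funpow_swap1)
      \<comment> \<open>The orbit of \<open>p\<close> would reach \<open>y\<close> at time
        \<open>n\<close>; there \<open>x 0\<close> replaces it, at the cost of a jump below
        \<delta>.\<close>
      define w where "w = (\<lambda>i. if i < n then (f ^^ i) p else x (i - n))"
      have "delta_chain f \<delta> (n + k) w"
        unfolding w_def using y(2) p(2) \<delta>(1)
        by (intro delta_chain_prepend_orbit[OF chain]) (auto simp: dist_commute)
      then have "delta_chain f \<delta>1 (n + k) w"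
        using \<delta>(3) unfolding delta_chain_def by (meson order_trans)
      moreover have "w i \<in> closed_nbhd b \<Lambda>" if "i \<le> n + k" for i
      proof -
        have "(f ^^ j) p \<in> V" for j
          by (induction j) (use p(1) fV in auto)
        then show ?thesis
          using that xV Vb by (auto simp: w_def)
      qed
      ultimately obtain z where z: "\<forall>i\<le>n + k. dist (w i) ((f ^^ i) z) \<le> \<epsilon>'"
        using \<delta>1(2) by blast
      have "dist (x k) ((f ^^ (n + k)) z) \<le> \<epsilon>'"
        using z[rule_format, of "n + k"] by (simp add: w_def)
      then have "(f ^^ (n + k)) z \<in> \<Lambda>"
        using \<eta>(2)[OF xK] \<epsilon>'(3) interior_subset by fastforce
      \<comment> \<open>\<Lambda> is its own image under each injective iterate, so membership at
        the end of the orbit passes back to \<open>z\<close>.\<close>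
      moreover have "(f ^^ j) ` \<Lambda> = \<Lambda>" for j
      proof (induction j)
        case (Suc j)
        then show ?case
          by (metis L(2) funpow.simps(2) image_comp)
      qed simp
      moreover have "inj (f ^^ (n + k))"
        using inj_homeomorphism_UNIV[OF homeomorphism_UNIV_funpow[OF hom]] .
      ultimately have "z \<in> \<Lambda>"
        by (metis inj_image_mem_iff)
      \<comment> \<open>Because \<open>n > 0\<close>, the chain \<open>w\<close> starts at
        \<open>p\<close> and not at \<open>x 0\<close>.\<close>
      moreover have "dist p z \<le> \<epsilon>'"
        using z[rule_format, of 0] n(2) by (simp add: w_def)
      ultimately show False
        using c(2)[of z p] pf \<epsilon>'(2) by (simp add: dist_commute)
    qed
    then show ?thesis
      using \<delta>(1) by blast
  qed
  then show ?thesis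
    using frontier_image_homeomorphism_UNIV[OF hom L] by (auto simp: chain_stable_def)
qed

end
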